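(* Let $l,r\ge 0$ be integers and let $S$ be the $(p,m,2)$ signed graph consisting of a negative edge, to which are attached $l$ positive pendant edges and a negative pendant edge at one end and $r$ positive pendant edges at the other end. Then $S$ is additively graceful if and only if $l=0$.
   Context: A signed graph $S$ is a finite simple graph on $p$ vertices in which $m$ edges are specified as positive and the remaining $n$ edges are specified as negative; it is then called a $(p,m,n)$ signed graph, with sets of positive and negative edges $E^+(S)$ and $E^-(S)$. Attaching a pendant edge at a vertex $z$ means adding a new vertex of degree 1 joined to $z$. Thus $S$ has negative edges $z_1z_2$, $z_1u$ and positive edges $z_1v_i$ ($1\le i\le l$), $z_2w_i$ ($1\le i\le r$), all these vertices being distinct, and no other vertices or edges. An additively graceful labeling of a $(p,m,n)$ signed graph $S=(V,E)$ is an injective map $f:V\to\{0,1,\dots,m+\lceil\frac{n+1}{2}\rceil\}$ such that, with $f^*(uv)=f(u)+f(v)$ for $uv\in E^-(S)$ and $f^*(uv)=|f(u)-f(v)|$ for $uv\in E^+(S)$, one has $\{f^*(uv):uv\in E^-(S)\}=\{1,2,\dots,n\}$ and $\{f^*(uv):uv\in E^+(S)\}=\{1,2,\dots,m\}$. $S$ is additively graceful if it admits such a labeling. *)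

theory Defs imports Complex_Main begin

record 'a signed_graph =
  verts :: "'a set"
  pos_edges :: "'a set set"
  neg_edges :: "'a set set"

text \<open>An edge is a two-element set of vertices.\<close>

definition signed_graph :: "nat \<Rightarrow> nat \<Rightarrow> nat \<Rightarrow> 'a signed_graph \<Rightarrow> bool" where
  "signed_graph p m n S \<longleftrightarrow>
     finite (verts S) \<and>
     (\<forall>e \<in> pos_edges S \<union> neg_edges S. e \<subseteq> verts S \<and> card e = 2) \<and>
     pos_edges S \<inter> neg_edges S = {} \<and>
     card (verts S) = p \<and> card (pos_edges S) = m \<and> card (neg_edges S) = n"

text \<open>A labeling is a total function on the vertex type; only its values on the vertex set matter.
  The absolute difference is formed over the integers because subtraction on \<^typ>\<open>nat\<close> truncates.\<close>

definition additively_graceful_labeling :: "'a signed_graph \<Rightarrow> ('a \<Rightarrow> nat) \<Rightarrow> bool" where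
  "additively_graceful_labeling S f \<longleftrightarrow>
     (let m = card (pos_edges S); n = card (neg_edges S) in
       inj_on f (verts S) \<and>
       f ` verts S \<subseteq> {0..m + nat \<lceil>(real n + 1) / 2\<rceil>} \<and>
       {f x + f y |x y. {x, y} \<in> neg_edges S} = {1..n} \<and>
       {nat \<bar>int (f x) - int (f y)\<bar> |x y. {x, y} \<in> pos_edges S} = {1..m})"

definition additively_graceful :: "'a signed_graph \<Rightarrow> bool" where
  "additively_graceful S \<longleftrightarrow> (\<exists>f. additively_graceful_labeling S f)"

text \<open>The negative edge \<open>z1 z2\<close> with positive pendant vertices \<open>vs\<close> and a negative pendant vertex \<open>u\<close>
  attached at \<open>z1\<close>, and positive pendant vertices \<open>ws\<close> attached at \<open>z2\<close>. It has this shape only if all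
  the listed vertices are distinct, which is left as a hypothesis.\<close>

definition pendant_graph :: "'a \<Rightarrow> 'a \<Rightarrow> 'a \<Rightarrow> 'a list \<Rightarrow> 'a list \<Rightarrow> 'a signed_graph" where
  "pendant_graph z1 z2 u vs ws =
     \<lparr> verts = {z1, z2, u} \<union> set vs \<union> set ws,
       pos_edges = {{z1, v} |v. v \<in> set vs} \<union> {{z2, w} |w. w \<in> set ws},
       neg_edges = {{z1, z2}, {z1, u}} \<rparr>"

lemma signed_graph_pendant_graph:
  assumes "distinct ([z1, z2, u] @ vs @ ws)"
  shows "signed_graph (length vs + length ws + 3) (length vs + length ws) 2
           (pendant_graph z1 z2 u vs ws)"
proof -
  let ?A = "(\<lambda>v. {z1, v}) ` set vs" and ?B = "(\<lambda>w. {z2, w}) ` set ws"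
  have pos: "pos_edges (pendant_graph z1 z2 u vs ws) = ?A \<union> ?B"
    by (auto simp: pendant_graph_def)
  have "card ?A = length vs" "card ?B = length ws"
    using assms by (auto simp: card_image inj_on_def doubleton_eq_iff distinct_card)
  moreover have "?A \<inter> ?B = {}"
    using assms by (auto simp: doubleton_eq_iff)
  ultimately have cpos: "card (?A \<union> ?B) = length vs + length ws"
    by (simp add: card_Un_disjoint)
  have "{z1, z2, u} \<union> set vs \<union> set ws = set ([z1, z2, u] @ vs @ ws)"
    by auto
  then have cverts: "card ({z1, z2, u} \<union> set vs \<union> set ws) = length vs + length ws + 3"
    using distinct_card[OF assms] by simp
  have "card {{z1, z2}, {z1, u}} = 2"
    using assms by (auto simp: doubleton_eq_iff)
  moreover have "\<forall>e \<in> ?A \<union> ?B \<union> {{z1, z2}, {z1, u}}. card e = 2"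
    using assms by (auto simp: card_2_iff)
  moreover have "(?A \<union> ?B) \<inter> {{z1, z2}, {z1, u}} = {}"
    using assms by (auto simp: doubleton_eq_iff)
  ultimately show ?thesis
    unfolding signed_graph_def pos using cpos cverts
    by (auto simp: pendant_graph_def)
qed

end

theory Submission imports Defs begin

text \<open>Call the labeling \<open>f\<close> and put \<open>m = l + r\<close>. The labels lie in \<open>{0..m + 2}\<close>. Distinct natural
  numbers with sums \<open>1\<close> and \<open>2\<close> along the two negative edges force the label \<open>0\<close> at their common end
  \<open>z1\<close> and the labels \<open>1\<close> and \<open>2\<close>, in some order, at \<open>z2\<close> and \<open>u\<close>; all pendant vertices on positive
  edges then carry labels from \<open>{3..m + 2}\<close>. So the edge \<open>z1 v\<close> has the label of \<open>v\<close> itself, which is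
  at least \<open>3\<close>, while \<open>z2 w\<close> has the label of \<open>w\<close> diminished by \<open>f z2\<close>.

  Suppose \<open>m \<ge> 1\<close>. The edge label \<open>1\<close> can come only from an edge \<open>z2 w\<close> with \<open>f z2 = 2\<close> and
  \<open>f w = 3\<close>. From here on a chain runs: the edge label \<open>k\<close> comes from a \<open>w\<close> with label \<open>k + 2\<close>, or from
  a \<open>v\<close> with label \<open>k\<close>, and the second is excluded because the label \<open>k\<close> was used by a \<open>w\<close> two steps
  before (or is too small to be used by a pendant vertex). Hence the labels \<open>3, \<dots>, m + 2\<close> all sit at
  the vertices \<open>w\<close>, and none is left for a \<open>v\<close>, so \<open>l = 0\<close>. If \<open>m = 0\<close>, then \<open>l = 0\<close> anyway.

  Conversely, for \<open>l = 0\<close> the enumeration \<open>z1, u, z2, w\<^sub>1, \<dots>, w\<^sub>r\<close> by \<open>0, 1, 2, \<dots>, r + 2\<close> is an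
  additively graceful labeling.\<close>

text \<open>Edges are unordered, so the two label sets in the definition range over both orientations of each
  edge. Since sums and absolute differences are symmetric, the orientation away from \<open>z1\<close> or \<open>z2\<close>
  alone gives the same sets.\<close>

lemma labeling_pendant_graph_iff:
  assumes dist: "distinct ([z1, z2, u] @ vs @ ws)"
  shows "additively_graceful_labeling (pendant_graph z1 z2 u vs ws) f \<longleftrightarrow>
     inj_on f ({z1, z2, u} \<union> set vs \<union> set ws) \<and>
     f ` ({z1, z2, u} \<union> set vs \<union> set ws) \<subseteq> {0..length vs + length ws + 2} \<and>
     {f z1 + f z2, f z1 + f u} = {1, 2} \<and>
     (\<lambda>v. nat \<bar>int (f z1) - int (f v)\<bar>) ` set vs \<union>
       (\<lambda>w. nat \<bar>int (f z2) - int (f w)\<bar>) ` set ws = {1..length vs + length ws}"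
proof -
  let ?S = "pendant_graph z1 z2 u vs ws"
  have card: "card (pos_edges ?S) = length vs + length ws" "card (neg_edges ?S) = 2"
    using signed_graph_pendant_graph[OF dist] by (auto simp: signed_graph_def)
  have verts: "verts ?S = {z1, z2, u} \<union> set vs \<union> set ws"
    by (simp add: pendant_graph_def)
  have neg: "{f x + f y |x y. {x, y} \<in> neg_edges ?S} = {f z1 + f z2, f z1 + f u}"
  proof -
    have "{x, y} \<in> neg_edges ?S \<longleftrightarrow>
        (x, y) \<in> {(z1, z2), (z2, z1), (z1, u), (u, z1)}" for x y
      by (auto simp: pendant_graph_def doubleton_eq_iff)
    then show ?thesis
      by (auto simp: add.commute)
  qed
  have pos: "{nat \<bar>int (f x) - int (f y)\<bar> |x y. {x, y} \<in> pos_edges ?S} =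
      (\<lambda>v. nat \<bar>int (f z1) - int (f v)\<bar>) ` set vs \<union>
      (\<lambda>w. nat \<bar>int (f z2) - int (f w)\<bar>) ` set ws" (is "?L = ?R")
  proof
    show "?L \<subseteq> ?R"
      by (auto simp: pendant_graph_def doubleton_eq_iff abs_minus_commute)
    have "{z1, v} \<in> pos_edges ?S" if "v \<in> set vs" for v
      using that by (auto simp: pendant_graph_def)
    moreover have "{z2, w} \<in> pos_edges ?S" if "w \<in> set ws" for w
      using that by (auto simp: pendant_graph_def)
    ultimately show "?R \<subseteq> ?L"
      by blast
  qed
  have ceil: "nat \<lceil>(real 2 + 1) / 2\<rceil> = 2"
    by (simp add: ceiling_eq_iff)
  have two: "{1..2::nat} = {1, 2}"
    by auto
  show ?thesis
    unfolding additively_graceful_labeling_def Let_def card verts neg pos ceil two ..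
qed

lemma pair_sums_one_two:
  fixes a b c :: nat
  assumes "{a + b, a + c} = {1, 2}" and "a \<noteq> b" "a \<noteq> c"
  shows "a = 0 \<and> {b, c} = {1, 2}"
proof -
  have "a + b = 1 \<and> a + c = 2 \<or> a + b = 2 \<and> a + c = 1"
    using assms(1) by (auto simp: doubleton_eq_iff)
  then have "a = 0"
    using assms(2,3) by linarith
  then show ?thesis
    using assms(1) by simp
qed

text \<open>The chain argument, freed from the graph: \<open>A\<close> and \<open>B\<close> stand for the label sets of the positive
  pendant vertices at \<open>z1\<close> and \<open>z2\<close>, and \<open>d\<close> for the label of \<open>z2\<close>. Covering \<open>1\<close> by labels that
  are at least \<open>3\<close> forces \<open>d = 2\<close>; after that, \<open>k \<in> A\<close> would clash with \<open>k = (k - 2) + 2 \<in> B\<close>,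
  known by induction.\<close>

lemma shifted_cover_all:
  fixes A B :: "nat set"
  assumes disj: "A \<inter> B = {}"
    and ge3: "\<And>x. x \<in> A \<union> B \<Longrightarrow> 3 \<le> x" and "d \<le> 2"
    and cover: "{1..m} \<subseteq> A \<union> (\<lambda>b. b - d) ` B"
    and "1 \<le> m"
  shows "{3..m + 2} \<subseteq> B"
proof -
  have "d = 2"
  proof -
    have "1 \<in> A \<union> (\<lambda>b. b - d) ` B"
      using cover \<open>1 \<le> m\<close> by auto
    then obtain b where "b \<in> B" "1 = b - d"
      using ge3 by force
    then show ?thesis
      using ge3[of b] \<open>d \<le> 2\<close> by auto
  qed
  have chain: "k + 2 \<in> B" if "1 \<le> k" "k \<le> m" for k
    using that
  proof (induction k rule: less_induct)
    case (less k)
    have "k \<notin> A"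
    proof
      assume "k \<in> A"
      then have "3 \<le> k" using ge3 by blast
      then have "k - 2 + 2 \<in> B"
        using less.prems by (intro less.IH) auto
      moreover have "k - 2 + 2 = k"
        using \<open>3 \<le> k\<close> by simp
      ultimately show False
        using \<open>k \<in> A\<close> disj by auto
    qed
    then obtain b where b: "b \<in> B" "k = b - 2"
      using cover less.prems \<open>d = 2\<close> by force
    then have "k + 2 = b"
      using ge3[of b] by simp
    with b show ?case
      by simp
  qed
  show ?thesis
  proof
    fix x assume "x \<in> {3..m + 2}"
    then have "x - 2 + 2 = x" "x - 2 + 2 \<in> B"
      using chain[of "x - 2"] by auto
    then show "x \<in> B"
      by simp
  qed
qed

lemma graceful_imp_no_pos_at_z1:
  assumes dist: "distinct ([z1, z2, u] @ vs @ ws)"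
    and lab: "additively_graceful_labeling (pendant_graph z1 z2 u vs ws) f"
  shows "vs = []"
proof (rule ccontr)
  assume "vs \<noteq> []"
  define V where "V = {z1, z2, u} \<union> set vs \<union> set ws"
  define m where "m = length vs + length ws"
  have inj: "inj_on f V" and range: "f ` V \<subseteq> {0..m + 2}"
    and neg: "{f z1 + f z2, f z1 + f u} = {1, 2}"
    and pos: "(\<lambda>v. nat \<bar>int (f z1) - int (f v)\<bar>) ` set vs \<union>
       (\<lambda>w. nat \<bar>int (f z2) - int (f w)\<bar>) ` set ws = {1..m}"
    using lab unfolding labeling_pendant_graph_iff[OF dist] V_def m_def by blast+
  have feq: "f x = f y \<longleftrightarrow> x = y" if "x \<in> V" "y \<in> V" for x y
    using inj that by (auto simp: inj_on_eq_iff)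
  have "f z1 \<noteq> f z2" "f z1 \<noteq> f u"
    using dist by (auto simp: feq V_def)
  then have z1: "f z1 = 0" and z2u: "{f z2, f u} = {1, 2}"
    using pair_sums_one_two[OF neg] by auto
  have ge3: "3 \<le> f x" if "x \<in> set vs \<union> set ws" for x
  proof -
    have "f x \<noteq> f z1" "f x \<noteq> f z2" "f x \<noteq> f u"
      using dist that by (auto simp: feq V_def)
    then show ?thesis
      using z1 z2u unfolding doubleton_eq_iff by linarith
  qed
  have "f z2 \<le> 2"
    using z2u by (auto simp: doubleton_eq_iff)
  have "(\<lambda>v. nat \<bar>int (f z1) - int (f v)\<bar>) ` set vs = f ` set vs"
    using z1 by simp
  moreover have "(\<lambda>w. nat \<bar>int (f z2) - int (f w)\<bar>) ` set ws = (\<lambda>b. b - f z2) ` f ` set ws"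
    unfolding image_image
  proof (rule image_cong[OF refl])
    fix w assume "w \<in> set ws"
    then show "nat \<bar>int (f z2) - int (f w)\<bar> = f w - f z2"
      using ge3[of w] \<open>f z2 \<le> 2\<close> by auto
  qed
  ultimately have cover: "{1..m} \<subseteq> f ` set vs \<union> (\<lambda>b. b - f z2) ` f ` set ws"
    using pos by simp
  have disj: "f ` set vs \<inter> f ` set ws = {}"
  proof -
    have "f v \<noteq> f w" if "v \<in> set vs" "w \<in> set ws" for v w
      using dist that by (auto simp: feq V_def)
    then show ?thesis by blast
  qed
  have "1 \<le> m"
    using \<open>vs \<noteq> []\<close> by (cases vs) (auto simp: m_def)
  then have full: "{3..m + 2} \<subseteq> f ` set ws"
    using shifted_cover_all[OF disj _ \<open>f z2 \<le> 2\<close> cover] ge3 by blast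
  have "hd vs \<in> set vs"
    using \<open>vs \<noteq> []\<close> by simp
  moreover from this have "f (hd vs) \<in> {0..m + 2}"
    using range by (auto simp: V_def)
  then have "f (hd vs) \<in> {3..m + 2}"
    using ge3[of "hd vs"] \<open>vs \<noteq> []\<close> by simp
  ultimately show False
    using full disj by blast
qed

lemma graceful_labeling_no_pos_at_z1:
  assumes dist: "distinct ([z1, z2, u] @ ws)"
  shows "\<exists>f. additively_graceful_labeling (pendant_graph z1 z2 u [] ws) f"
proof -
  define xs where "xs = [z1, u, z2] @ ws"
  have "distinct xs"
    using dist by (auto simp: xs_def)
  then have bij: "bij_betw ((!) xs) {..<length xs} (set xs)"
    by (simp add: bij_betw_nth)
  define f where "f = inv_into {..<length xs} ((!) xs)"
  have bijf: "bij_betw f (set xs) {..<length xs}"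
    unfolding f_def by (rule bij_betw_inv_into[OF bij])
  have f_nth: "f (xs ! i) = i" if "i < length xs" for i
    unfolding f_def using bij that by (simp add: bij_betw_def)
  have z: "f z1 = 0" "f u = 1" "f z2 = 2"
    using f_nth[of 0] f_nth[of 1] f_nth[of 2] by (auto simp: xs_def)
  have w: "f (ws ! i) = i + 3" if "i < length ws" for i
    using f_nth[of "i + 3"] that by (simp add: xs_def numeral_3_eq_3)
  have V: "{z1, z2, u} \<union> set [] \<union> set ws = set xs"
    by (auto simp: xs_def)
  have "(\<lambda>w. nat \<bar>int (f z2) - int (f w)\<bar>) ` set ws =
      (\<lambda>i. nat \<bar>int (f z2) - int (f (ws ! i))\<bar>) ` {..<length ws}"
    by (auto simp: set_conv_nth)
  also have "\<dots> = Suc ` {..<length ws}"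
    by (rule image_cong) (auto simp: z w)
  also have "\<dots> = {1..length ws}"
    by (simp add: image_Suc_lessThan)
  finally have pos: "(\<lambda>w. nat \<bar>int (f z2) - int (f w)\<bar>) ` set ws = {1..length ws}" .
  have "f ` set xs \<subseteq> {0..length ws + 2}"
    using bijf by (auto simp: bij_betw_def xs_def)
  then have "additively_graceful_labeling (pendant_graph z1 z2 u [] ws) f"
    using labeling_pendant_graph_iff[of z1 z2 u "[]" ws f] dist bijf pos
    unfolding V by (auto simp: bij_betw_def z)
  then show ?thesis
    by blast
qed

theorem theorem4p11:
  fixes l r :: nat and z1 z2 u :: 'a and vs ws :: "'a list" and S :: "'a signed_graph"
  assumes "distinct ([z1, z2, u] @ vs @ ws)"
    and "length vs = l" and "length ws = r"
    and "S = pendant_graph z1 z2 u vs ws"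
  shows "additively_graceful S \<longleftrightarrow> l = 0"
proof
  assume "additively_graceful S"
  then show "l = 0"
    using graceful_imp_no_pos_at_z1[OF assms(1)] assms(2,4)
    by (auto simp: additively_graceful_def)
next
  assume "l = 0"
  then have "vs = []"
    using assms(2) by simp
  then show "additively_graceful S"
    using graceful_labeling_no_pos_at_z1[of z1 z2 u ws] assms(1,4)
    by (auto simp: additively_graceful_def)
qed

end
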